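(* Let $G=(V,E)$ be a finite connected graph with at least two vertices, and let $F_0\subseteq F_1\subseteq F_2\subseteq\cdots\subseteq V\times V$ be the sets of pairs defined recursively in the context. If $(x,y)$ belongs to $\bigcup_{i=0}^{\infty}F_i$, then $(x,y)$ is a forbidden state for $G$.
   Context: Here $x\sim y$ means adjacent, $N(x)$ is the set of neighbors of $x$, and $d(x)=|N(x)|$. A simple random walk on $G$ moves from $v$ to each neighbor with probability $1/d(v)$. A Markovian avoidance process of two tokens $X,Y$ on $V$ is a (time-homogeneous) Markov chain on $V\times V$ with transition probabilities $T[(x,y)\rightarrow(x',y')]$ and stationary distribution $s$, such that $s(v,v)=0$ for all $v\in V$, and whenever $s(v,w)>0$ one has $T[(v,w)\rightarrow(w,u)]=0$ for all $u\in V$. A uniform avoidance coupling of two simple random walks on $G$ is a Markovian avoidance process such that for every state $(x,y)$ with $s(x,y)>0$: $\sum_{y'}T[(x,y)\rightarrow(x',y')]$ equals $1/d(x)$ if $x'\sim x$ and $0$ otherwise, and $\sum_{x'}T[(x,y)\rightarrow(x',y')]$ equals $1/d(y)$ if $y'\sim y$ and $0$ otherwise. A forbidden state for $G$ is a pair $(x,y)\in V\times V$ such that there is no uniform avoidance coupling of two simple random walks on $G$ in which $(x,y)$ has non-zero stationary probability. Recursive definition: $F_0=\{(x,y)\in V\times V: x\sim y\}$. Given $F_i$, the set $F_{i+1}$ consists of all elements of $F_i$ together with all $(x,y)\notin F_i$ that fail the following test. Form the bipartite graph with left side $N(x)$ and right side $N(y)$ (a common neighbor of $x$ and $y$ has one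 copy on each side), with an arc from $x'\in N(x)$ to $y'\in N(y)$ if and only if $x'\ne y'$ and $(x',y')\notin F_i$. The pair $(x,y)$ passes the test if and only if there is a nonnegative flow on the arcs such that each left node sends out total $1/d(x)$ and each right node receives total $1/d(y)$. (When $d(y)\ge d(x)$ this is equivalent to: every $A\subseteq N(x)$ has at least $|A|\,d(y)/d(x)$ out-neighbors on the right side.) *)

theory Defs
  imports
    "HOL-Probability.Probability_Mass_Function"
    "Graph_Theory.Digraph"
    "Graph_Theory.Digraph_Component"
begin

text \<open>A finite simple graph is an instance of the locale \<^locale>\<open>graph\<close>: undirected edges are
  symmetric pairs of arcs, so adjacency is the relation \<open>v \<rightarrow>\<^bsub>G\<^esub> w\<close>.\<close>

definition nbrs :: "('a, 'b) pre_digraph \<Rightarrow> 'a \<Rightarrow> 'a set" where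
  "nbrs G v = {w \<in> verts G. v \<rightarrow>\<^bsub>G\<^esub> w}"

definition deg :: "('a, 'b) pre_digraph \<Rightarrow> 'a \<Rightarrow> nat" where
  "deg G v = card (nbrs G v)"

text \<open>A Markov chain on a state set \<open>S\<close> is given by its transition kernel; the transition
  probability from \<open>z\<close> to \<open>z'\<close> is \<open>pmf (T z) z'\<close>. The values of \<open>T\<close> outside \<open>S\<close> are irrelevant.\<close>

definition markov_kernel_on :: "'s set \<Rightarrow> ('s \<Rightarrow> 's pmf) \<Rightarrow> bool" where
  "markov_kernel_on S T \<longleftrightarrow> (\<forall>z\<in>S. set_pmf (T z) \<subseteq> S)"

definition stationary_on :: "'s set \<Rightarrow> ('s \<Rightarrow> 's pmf) \<Rightarrow> 's pmf \<Rightarrow> bool" where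
  "stationary_on S T s \<longleftrightarrow> set_pmf s \<subseteq> S \<and> bind_pmf s T = s"

definition markovian_avoidance_process ::
  "'a set \<Rightarrow> ('a \<times> 'a \<Rightarrow> ('a \<times> 'a) pmf) \<Rightarrow> ('a \<times> 'a) pmf \<Rightarrow> bool" where
  "markovian_avoidance_process V T s \<longleftrightarrow>
     markov_kernel_on (V \<times> V) T \<and> stationary_on (V \<times> V) T s \<and>
     (\<forall>v\<in>V. pmf s (v, v) = 0) \<and>
     (\<forall>v\<in>V. \<forall>w\<in>V. pmf s (v, w) > 0 \<longrightarrow> (\<forall>u\<in>V. pmf (T (v, w)) (w, u) = 0))"

definition uniform_avoidance_coupling ::
  "('a, 'b) pre_digraph \<Rightarrow> ('a \<times> 'a \<Rightarrow> ('a \<times> 'a) pmf) \<Rightarrow> ('a \<times> 'a) pmf \<Rightarrow> bool" where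
  "uniform_avoidance_coupling G T s \<longleftrightarrow>
     markovian_avoidance_process (verts G) T s \<and>
     (\<forall>x\<in>verts G. \<forall>y\<in>verts G. pmf s (x, y) > 0 \<longrightarrow>
        (\<forall>x'\<in>verts G. (\<Sum>y'\<in>verts G. pmf (T (x, y)) (x', y')) =
                          (if x' \<in> nbrs G x then 1 / real (deg G x) else 0)) \<and>
        (\<forall>y'\<in>verts G. (\<Sum>x'\<in>verts G. pmf (T (x, y)) (x', y')) =
                          (if y' \<in> nbrs G y then 1 / real (deg G y) else 0)))"

definition forbidden_state :: "('a, 'b) pre_digraph \<Rightarrow> 'a \<times> 'a \<Rightarrow> bool" where
  "forbidden_state G z \<longleftrightarrow> z \<in> verts G \<times> verts G \<and>
     \<not> (\<exists>T s. uniform_avoidance_coupling G T s \<and> pmf s z \<noteq> 0)"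

text \<open>Arcs of the bipartite graph: the first component is a left node, the second component a
  right node, so a common neighbour of \<open>x\<close> and \<open>y\<close> has a copy on each side.\<close>

definition test_arcs ::
  "('a, 'b) pre_digraph \<Rightarrow> ('a \<times> 'a) set \<Rightarrow> 'a \<Rightarrow> 'a \<Rightarrow> ('a \<times> 'a) set" where
  "test_arcs G F x y =
     {(x', y'). x' \<in> nbrs G x \<and> y' \<in> nbrs G y \<and> x' \<noteq> y' \<and> (x', y') \<notin> F}"

definition passes_test ::
  "('a, 'b) pre_digraph \<Rightarrow> ('a \<times> 'a) set \<Rightarrow> 'a \<Rightarrow> 'a \<Rightarrow> bool" where
  "passes_test G F x y \<longleftrightarrow>
     (\<exists>f :: 'a \<times> 'a \<Rightarrow> real.
        (\<forall>a \<in> test_arcs G F x y. f a \<ge> 0) \<and>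
        (\<forall>x'\<in>nbrs G x.
           (\<Sum>y' | (x', y') \<in> test_arcs G F x y. f (x', y')) = 1 / real (deg G x)) \<and>
        (\<forall>y'\<in>nbrs G y.
           (\<Sum>x' | (x', y') \<in> test_arcs G F x y. f (x', y')) = 1 / real (deg G y)))"

primrec forb :: "('a, 'b) pre_digraph \<Rightarrow> nat \<Rightarrow> ('a \<times> 'a) set" where
  "forb G 0 = {(x, y) \<in> verts G \<times> verts G. x \<rightarrow>\<^bsub>G\<^esub> y}"
| "forb G (Suc i) = forb G i \<union>
     {(x, y) \<in> verts G \<times> verts G. (x, y) \<notin> forb G i \<and> \<not> passes_test G (forb G i) x y}"

end

theory Submission
  imports Defs
begin

text \<open>The support of the stationary distribution is closed under the transitions of the chain.
  If it avoids \<open>F\<^sub>i\<close>, then the transition probabilities out of a supported state \<open>(x, y)\<close> are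
  themselves a flow witnessing that \<open>(x, y)\<close> passes the test for \<open>F\<^sub>i\<close>, so the support avoids
  \<open>F\<^sub>i\<^sub>+\<^sub>1\<close>. It avoids \<open>F\<^sub>0\<close> because the first token must step onto each neighbour of its position
  with positive probability, and so onto the second token if that is adjacent.\<close>

text \<open>One step started from \<open>s\<close> has law \<open>s\<close> again, so the support of
  \<open>s\<close> is the union of the supports of \<open>T z\<close> over all \<open>z\<close> in
  it.\<close>

lemma stationary_on_support_closed:
  assumes "stationary_on S T s" "z \<in> set_pmf s"
  shows "set_pmf (T z) \<subseteq> set_pmf s"
proof -
  have "set_pmf (bind_pmf s T) = set_pmf s"
    using assms(1) by (simp add: stationary_on_def)
  with assms(2) show ?thesis
    unfolding set_bind_pmf by blast
qed

lemma finite_nbrs: "finite (verts G) \<Longrightarrow> finite (nbrs G v)"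
  by (simp add: nbrs_def)

lemma nbrs_subset_verts: "nbrs G v \<subseteq> verts G"
  by (auto simp: nbrs_def)

context
  fixes G :: "('a, 'b) pre_digraph" and T :: "'a \<times> 'a \<Rightarrow> ('a \<times> 'a) pmf" and s :: "('a \<times> 'a) pmf"
  assumes fin: "finite (verts G)" and coupling: "uniform_avoidance_coupling G T s"
begin

lemma process: "markovian_avoidance_process (verts G) T s"
  using coupling by (simp add: uniform_avoidance_coupling_def)

lemma stationary: "stationary_on (verts G \<times> verts G) T s"
  using process by (simp add: markovian_avoidance_process_def)

lemma support_in_verts:
  assumes "(x, y) \<in> set_pmf s"
  shows "x \<in> verts G" "y \<in> verts G"
  using assms stationary by (auto simp: stationary_on_def)

lemma support_off_diagonal: "(x, y) \<in> set_pmf s \<Longrightarrow> x \<noteq> y"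
  using process support_in_verts by (auto simp: markovian_avoidance_process_def set_pmf_iff)

lemma left_marginal:
  assumes "(x, y) \<in> set_pmf s" "x' \<in> verts G"
  shows "(\<Sum>y'\<in>verts G. pmf (T (x, y)) (x', y')) =
    (if x' \<in> nbrs G x then 1 / real (deg G x) else 0)"
  using assms coupling support_in_verts[OF assms(1)]
  by (simp add: uniform_avoidance_coupling_def pmf_positive)

lemma right_marginal:
  assumes "(x, y) \<in> set_pmf s" "y' \<in> verts G"
  shows "(\<Sum>x'\<in>verts G. pmf (T (x, y)) (x', y')) =
    (if y' \<in> nbrs G y then 1 / real (deg G y) else 0)"
  using assms coupling support_in_verts[OF assms(1)]
  by (simp add: uniform_avoidance_coupling_def pmf_positive)

lemma support_not_adjacent:
  assumes "(x, y) \<in> set_pmf s"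
  shows "\<not> x \<rightarrow>\<^bsub>G\<^esub> y"
proof
  assume "x \<rightarrow>\<^bsub>G\<^esub> y"
  then have y: "y \<in> nbrs G x"
    using support_in_verts[OF assms] by (simp add: nbrs_def)
  \<comment> \<open>Positivity matters because 1 / 0 = 0: a zero degree would make the marginal at
    \<open>y\<close> vanish without contradiction.\<close>
  then have "deg G x > 0"
    using fin by (auto simp: deg_def card_gt_0_iff finite_nbrs)
  \<comment> \<open>Avoidance kills every term: the first token may not enter the place the second
    one held before the move.\<close>
  moreover have "(\<Sum>u\<in>verts G. pmf (T (x, y)) (y, u)) = 0"
    using process support_in_verts[OF assms] pmf_positive[OF assms]
    by (auto simp: markovian_avoidance_process_def intro!: sum.neutral)
  ultimately show False
    using left_marginal[OF assms, of y] y support_in_verts[OF assms] by simp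
qed

text \<open>A single transition probability is at most the marginal of either token, and the
  marginals vanish off the neighbourhoods. Closedness of the support ensures that \<open>x'\<close>
  and \<open>y'\<close> are vertices, where the marginals are known.\<close>

lemma transition_in_nbrs:
  assumes s: "(x, y) \<in> set_pmf s" and T: "(x', y') \<in> set_pmf (T (x, y))"
  shows "x' \<in> nbrs G x" "y' \<in> nbrs G y"
proof -
  have "(x', y') \<in> set_pmf s"
    using stationary_on_support_closed[OF stationary s] T by blast
  note V = support_in_verts[OF this]
  have pos: "0 < pmf (T (x, y)) (x', y')"
    using T by (rule pmf_positive)
  also have "\<dots> \<le> (\<Sum>v\<in>verts G. pmf (T (x, y)) (x', v))"
    using V fin by (intro member_le_sum) auto
  finally show "x' \<in> nbrs G x"
    using left_marginal[OF s V(1)] by (auto split: if_splits)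
  note pos
  also have "pmf (T (x, y)) (x', y') \<le> (\<Sum>v\<in>verts G. pmf (T (x, y)) (v, y'))"
    using V fin by (intro member_le_sum[where f = "\<lambda>v. pmf (T (x, y)) (v, y')"]) auto
  finally show "y' \<in> nbrs G y"
    using right_marginal[OF s V(2)] by (auto split: if_splits)
qed

text \<open>Stated for any \<open>F\<close> missed by the support, so that the induction on
  \<open>i\<close> can take \<open>F\<close> to be \<open>forb G i\<close>.\<close>

lemma support_passes_test:
  assumes s: "(x, y) \<in> set_pmf s" and F: "set_pmf s \<inter> F = {}"
  shows "passes_test G F x y"
proof -
  let ?A = "test_arcs G F x y" and ?f = "pmf (T (x, y))"
  \<comment> \<open>A possible transition ends in the support, hence off the diagonal and outside
    \<open>F\<close>.\<close>
  have supp: "(x', y') \<in> ?A" if "(x', y') \<in> set_pmf (T (x, y))" for x' y'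
  proof -
    have "(x', y') \<in> set_pmf s"
      using stationary_on_support_closed[OF stationary s] that by blast
    then show ?thesis
      using transition_in_nbrs[OF s that] F support_off_diagonal by (auto simp: test_arcs_def)
  qed
  have A: "x' \<in> verts G \<and> y' \<in> verts G" if "(x', y') \<in> ?A" for x' y'
    using that by (auto simp: test_arcs_def nbrs_def)
  have "(\<Sum>y' | (x', y') \<in> ?A. ?f (x', y')) = 1 / real (deg G x)" if "x' \<in> nbrs G x" for x'
  proof -
    \<comment> \<open>Pairs that are not arcs have probability 0 by \<open>supp\<close>, so the
      outflow of \<open>x'\<close> is the full marginal.\<close>
    have "(\<Sum>y' | (x', y') \<in> ?A. ?f (x', y')) = (\<Sum>y'\<in>verts G. ?f (x', y'))"
      using fin A supp by (intro sum.mono_neutral_left) (auto simp: set_pmf_iff)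
    then show ?thesis
      using left_marginal[OF s, of x'] that nbrs_subset_verts[of G x] by auto
  qed
  moreover have "(\<Sum>x' | (x', y') \<in> ?A. ?f (x', y')) = 1 / real (deg G y)"
    if "y' \<in> nbrs G y" for y'
  proof -
    have "(\<Sum>x' | (x', y') \<in> ?A. ?f (x', y')) = (\<Sum>x'\<in>verts G. ?f (x', y'))"
      using fin A supp by (intro sum.mono_neutral_left) (auto simp: set_pmf_iff)
    then show ?thesis
      using right_marginal[OF s, of y'] that nbrs_subset_verts[of G y] by auto
  qed
  ultimately show ?thesis
    unfolding passes_test_def by (intro exI[of _ ?f]) simp
qed

lemma support_disjoint_forb: "set_pmf s \<inter> forb G i = {}"
proof (induction i)
  case 0
  then show ?case
    using support_not_adjacent by auto
next
  case (Suc i)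
  then show ?case
    using support_passes_test[OF _ Suc.IH] by auto
qed

end

lemma forb_subset: "forb G i \<subseteq> verts G \<times> verts G"
  by (induction i) auto

theorem theorem7p4:
  fixes G :: "('a, 'b) pre_digraph" and x y :: 'a
  assumes "graph G"
    and "Digraph_Component.connected G"
    and "card (verts G) \<ge> 2"
    and "(x, y) \<in> (\<Union>i. forb G i)"
  shows "forbidden_state G (x, y)"
proof -
  interpret graph G by fact
  obtain i where i: "(x, y) \<in> forb G i"
    using assms(4) by blast
  have "pmf s (x, y) = 0" if "uniform_avoidance_coupling G T s" for T s
    using support_disjoint_forb[OF finite_verts that, of i] i by (auto simp: set_pmf_iff)
  \<comment> \<open>A forbidden state must also be a pair of vertices, which
    \<open>forb_subset\<close> supplies.\<close>
  then show ?thesis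
    using i forb_subset[of G i] unfolding forbidden_state_def by blast
qed

end
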